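(* Let $U\subseteq R_{2,1}$ be a four-dimensional subspace. If $I_U$ has a linear first syzygy of bidegree $(1,0)$, then \[I_U=\langle ps,pt,p_2,p_3\rangle\] for some $p$ homogeneous of bidegree $(1,1)$ and some $p_2,p_3\in R_{2,1}$.
   Context: $k$ is an algebraically closed field and $R=k[s,t,u,v]$ is bigraded with $s,t$ of degree $(1,0)$ and $u,v$ of degree $(0,1)$; $R_{m,n}$ is the graded piece of bidegree $(m,n)$. For a four-dimensional subspace $U=\mathrm{Span}\{p_0,p_1,p_2,p_3\}\subseteq R_{2,1}$, $I_U=\langle p_0,p_1,p_2,p_3\rangle\subset R$. (The conclusion allows a new choice of generators.) A first syzygy of bidegree $(a,b)$ on $I_U$ is a nonzero tuple $(g_0,\dots,g_3)\in R_{a,b}^4$ with $\sum g_ip_i=0$. *)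

theory Defs
  imports "HOL-Library.Poly_Mapping" "HOL-Computational_Algebra.Polynomial"
begin

datatype bivar = Var_s | Var_t | Var_u | Var_v

text \<open>The ring \<open>R = k[s,t,u,v]\<close>: finitely supported maps from exponent vectors to coefficients,
  with the convolution product of \<open>Poly_Mapping\<close>.\<close>

type_synonym 'k bipoly = "(bivar \<Rightarrow>\<^sub>0 nat) \<Rightarrow>\<^sub>0 'k"

definition X :: "bivar \<Rightarrow> 'k::zero_neq_one bipoly"
  where "X x = Poly_Mapping.single (Poly_Mapping.single x 1) 1"

text \<open>The graded piece \<open>R\<^bsub>m,n\<^esub>\<close>. It contains the zero polynomial.\<close>

definition bigraded :: "nat \<Rightarrow> nat \<Rightarrow> 'k::zero bipoly set"
  where "bigraded m n = {f. \<forall>e\<in>Poly_Mapping.keys f.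
    Poly_Mapping.lookup e Var_s + Poly_Mapping.lookup e Var_t = m \<and>
    Poly_Mapping.lookup e Var_u + Poly_Mapping.lookup e Var_v = n}"

definition pscale :: "'k::field \<Rightarrow> 'k bipoly \<Rightarrow> 'k bipoly"
  where "pscale c f = Poly_Mapping.map ((*) c) f"

lemma pscale_conv_mult: "pscale c f = Poly_Mapping.single 0 c * f"
  by (simp add: pscale_def mult_map_scale_conv_mult)

global_interpretation bipoly: vector_space "pscale :: 'k::field \<Rightarrow> 'k bipoly \<Rightarrow> 'k bipoly"
  by unfold_locales
    (simp_all add: pscale_conv_mult distrib_left distrib_right single_add
      mult_single flip: mult.assoc)

text \<open>The ideal generated by a set, i.e. its span in the ring as a module over itself.\<close>

definition ideal_gen :: "'a::comm_ring_1 set \<Rightarrow> 'a set"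
  where "ideal_gen S = module.span (*) S"

text \<open>Only the values of \<open>p\<close> and \<open>g\<close> at \<open>0,\<dots>,3\<close> matter.\<close>

definition first_syzygy ::
    "nat \<Rightarrow> nat \<Rightarrow> (nat \<Rightarrow> 'k::field bipoly) \<Rightarrow> (nat \<Rightarrow> 'k bipoly) \<Rightarrow> bool"
  where "first_syzygy a b p g \<longleftrightarrow>
    (\<forall>i<4. g i \<in> bigraded a b) \<and> (\<exists>i<4. g i \<noteq> 0) \<and> (\<Sum>i<4. g i * p i) = 0"

end

(* A syzygy with entries a_i s + b_i t says that s A = t B, where A = sum a_i p_i and
   B = - sum b_i p_i lie in U. Hence A = t q and B = s q for some q of bidegree (1,1), and
   q is nonzero because the p_i are linearly independent. Since q s and q t are linearly
   independent elements of U, they extend to a basis of U, which generates the ideal. *)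
theory Submission
  imports Defs
begin

text \<open>Updating at a fresh key is the same as adding a single term, because the old value there
  is 0. The rule reduces claims that are additive in \<open>f\<close> to monomials, with no
  freshness condition to carry.\<close>

lemma poly_mapping_add_single_induct [case_names zero add_single]:
  fixes f :: "'a \<Rightarrow>\<^sub>0 'b::monoid_add"
  assumes "P 0"
    and add_single: "\<And>f k c. P f \<Longrightarrow> P (f + Poly_Mapping.single k c)"
  shows "P f"
proof (induction f rule: update_induct)
  case const
  show ?case by fact
next
  case (update f k c)
  then have "Poly_Mapping.update k c f = f + Poly_Mapping.single k c"
    by (intro poly_mapping_eqI)
      (auto simp: lookup_update lookup_add lookup_single when_def in_keys_iff)
  then show ?case
    using add_single update by simp
qed

text \<open>Both sides are additive in \<open>f\<close>, and on a monomial the claim is cancellation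
  of exponents.\<close>

lemma lookup_X_times:
  fixes f :: "'k::comm_ring_1 bipoly"
  shows "Poly_Mapping.lookup (X x * f) (Poly_Mapping.single x 1 + e) = Poly_Mapping.lookup f e"
proof (induction f rule: poly_mapping_add_single_induct)
  case zero
  then show ?case by simp
next
  case (add_single f e' c)
  then show ?case
    by (simp add: X_def mult_single lookup_single distrib_left lookup_add)
qed

lemma lookup_X_times_eq_0:
  fixes f :: "'k::comm_ring_1 bipoly"
  assumes "Poly_Mapping.lookup e x = 0"
  shows "Poly_Mapping.lookup (X x * f) e = 0"
proof (induction f rule: poly_mapping_add_single_induct)
  case zero
  then show ?case by simp
next
  case (add_single f e' c)
  have "Poly_Mapping.single x 1 + e' \<noteq> e"
    using assms by (auto simp: lookup_add)
  then show ?case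
    using add_single by (simp add: X_def mult_single lookup_single distrib_left lookup_add)
qed

lemma X_times_cancel:
  fixes f g :: "'k::comm_ring_1 bipoly"
  assumes "X x * f = X x * g"
  shows "f = g"
  by (rule poly_mapping_eqI) (metis assms lookup_X_times)

lemma single_split:
  assumes "Poly_Mapping.lookup e x \<noteq> (0::nat)"
  shows "\<exists>e'. e = Poly_Mapping.single x 1 + e'"
proof
  show "e = Poly_Mapping.single x 1 + (e - Poly_Mapping.single x 1)"
    using assms
    by (intro poly_mapping_eqI) (auto simp: lookup_add lookup_minus lookup_single when_def)
qed

text \<open>The quotient is \<open>f\<close> pulled back along the exponent shift; the hypothesis
  says that no coefficient lies outside the image of that shift.\<close>

lemma X_dvdI:
  fixes f :: "'k::comm_ring_1 bipoly"
  assumes "\<And>e. Poly_Mapping.lookup e x = 0 \<Longrightarrow> Poly_Mapping.lookup f e = 0"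
  shows "\<exists>q. f = X x * q"
proof
  let ?q = "Poly_Mapping.map_key (\<lambda>e. Poly_Mapping.single x 1 + e) f"
  show "f = X x * ?q"
  proof (rule poly_mapping_eqI)
    fix e
    show "Poly_Mapping.lookup f e = Poly_Mapping.lookup (X x * ?q) e"
    proof (cases "Poly_Mapping.lookup e x = 0")
      case True
      then show ?thesis
        by (simp add: assms lookup_X_times_eq_0)
    next
      case False
      from single_split[OF this] obtain e' where e': "e = Poly_Mapping.single x 1 + e'" ..
      \<comment> \<open>\<open>map_key\<close> composes with the key map only if that map is
        injective; otherwise its value is 0 by default.\<close>
      have "inj (\<lambda>e :: bivar \<Rightarrow>\<^sub>0 nat. Poly_Mapping.single x 1 + e)"
        by (simp add: inj_on_def)
      then show ?thesis
        unfolding e' lookup_X_times by (simp only: map_key.rep_eq comp_apply)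
    qed
  qed
qed

text \<open>This is coprimality of two distinct variables, by hand: a term of \<open>A\<close> free
  of \<open>y\<close> would give a term of \<open>X x * A\<close> free of \<open>y\<close>, but
  \<open>X y * B\<close> has none. So \<open>y\<close> divides \<open>A\<close>, and cancelling
  \<open>y\<close> gives \<open>B\<close>.\<close>

lemma X_times_eqE:
  fixes A B :: "'k::comm_ring_1 bipoly"
  assumes "X x * A = X y * B" and "x \<noteq> y"
  obtains q where "A = X y * q" and "B = X x * q"
proof -
  have "Poly_Mapping.lookup A e = 0" if "Poly_Mapping.lookup e y = 0" for e
  proof -
    have "Poly_Mapping.lookup A e = Poly_Mapping.lookup (X y * B) (Poly_Mapping.single x 1 + e)"
      using assms(1) by (metis lookup_X_times)
    then show ?thesis
      using that assms(2) by (simp add: lookup_X_times_eq_0 lookup_add lookup_single)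
  qed
  then obtain q where q: "A = X y * q"
    using X_dvdI by blast
  then have "X y * B = X y * (X x * q)"
    using assms(1) by (simp add: ac_simps)
  then show ?thesis
    using that q X_times_cancel by blast
qed

lemma bigraded_X_t_times_cancel:
  fixes q :: "'k::comm_ring_1 bipoly"
  assumes "X Var_t * q \<in> bigraded (Suc m) n"
  shows "q \<in> bigraded m n"
  unfolding bigraded_def
proof (intro CollectI ballI)
  fix e assume e: "e \<in> Poly_Mapping.keys q"
  let ?e = "Poly_Mapping.single Var_t 1 + e"
  have "?e \<in> Poly_Mapping.keys (X Var_t * q)"
    using e by (simp only: in_keys_iff lookup_X_times not_False_eq_True)
  from bspec[OF assms[unfolded bigraded_def mem_Collect_eq] this]
  show "Poly_Mapping.lookup e Var_s + Poly_Mapping.lookup e Var_t = m \<and>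
      Poly_Mapping.lookup e Var_u + Poly_Mapping.lookup e Var_v = n"
    by (simp add: lookup_add lookup_single)
qed

lemma bigraded_1_0_linear:
  fixes g :: "'k::field bipoly"
  assumes "g \<in> bigraded 1 0"
  shows "\<exists>a b. g = pscale a (X Var_s) + pscale b (X Var_t)"
proof (intro exI)
  let ?s = "Poly_Mapping.single Var_s (1::nat)" and ?t = "Poly_Mapping.single Var_t (1::nat)"
  have ne: "?s \<noteq> ?t"
    by (metis bivar.distinct(1) lookup_single_eq lookup_single_not_eq zero_neq_one)
  show "g = pscale (Poly_Mapping.lookup g ?s) (X Var_s) + pscale (Poly_Mapping.lookup g ?t) (X Var_t)"
  proof (rule poly_mapping_eqI)
    fix e
    have "e = ?s \<or> e = ?t" if "e \<in> Poly_Mapping.keys g"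
    proof -
      have d: "Poly_Mapping.lookup e Var_s + Poly_Mapping.lookup e Var_t = 1"
        "Poly_Mapping.lookup e Var_u = 0" "Poly_Mapping.lookup e Var_v = 0"
        using assms that by (auto simp: bigraded_def)
      show ?thesis
      \<comment> \<open>The bidegree leaves only two exponent vectors, told apart by the exponent of
        \<open>s\<close>.\<close>
      proof (cases "Poly_Mapping.lookup e Var_s = 0")
        case True
        have "Poly_Mapping.lookup e x = Poly_Mapping.lookup ?t x" for x
          using d True by (cases x) (auto simp: lookup_single)
        then show ?thesis by (auto intro: poly_mapping_eqI)
      next
        case False
        have "Poly_Mapping.lookup e x = Poly_Mapping.lookup ?s x" for x
          using d False by (cases x) (auto simp: lookup_single)
        then show ?thesis by (auto intro: poly_mapping_eqI)
      qed
    qed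
    then show "Poly_Mapping.lookup g e = Poly_Mapping.lookup
        (pscale (Poly_Mapping.lookup g ?s) (X Var_s) + pscale (Poly_Mapping.lookup g ?t) (X Var_t)) e"
      using ne
      by (cases "e = ?s"; cases "e = ?t")
        (auto simp: pscale_conv_mult X_def mult_single lookup_add lookup_single when_def in_keys_iff)
  qed
qed

text \<open>Scaling is multiplication by a constant polynomial, so every ideal is closed under
  linear combinations over the field. Hence the ideal depends only on the subspace, and any basis of
  it may serve as generators.\<close>

lemma ideal_gen_bipoly_span:
  fixes S :: "'k::field bipoly set"
  shows "ideal_gen (bipoly.span S) = ideal_gen S"
proof -
  interpret I: module "(*) :: 'k bipoly \<Rightarrow> _"
    by unfold_locales (simp_all add: algebra_simps)
  have "bipoly.span S \<subseteq> I.span S"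
  proof (rule bipoly.span_minimal)
    show "S \<subseteq> I.span S"
      by (rule I.span_superset)
    show "bipoly.subspace (I.span S)"
      by (auto simp: bipoly.subspace_def pscale_conv_mult I.span_zero intro: I.span_add I.span_scale)
  qed
  then show ?thesis
    unfolding ideal_gen_def
    by (intro subset_antisym I.span_mono bipoly.span_superset I.span_minimal I.subspace_span)
qed

lemma X_times_neq_pscale_X_times:
  fixes q :: "'k::field bipoly"
  assumes "q \<noteq> 0" and "x \<noteq> y"
  shows "X x * q \<noteq> pscale c (X y * q)"
proof
  assume "X x * q = pscale c (X y * q)"
  then have eq: "X x * q = X y * pscale c q"
    by (simp add: pscale_conv_mult ac_simps)
  \<comment> \<open>A monomial of \<open>q\<close> of maximal \<open>x\<close>-degree yields one of larger \<open>x\<close>-degree.\<close>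
  define m where "m = Max ((\<lambda>e. Poly_Mapping.lookup e x) ` Poly_Mapping.keys q)"
  have "m \<in> (\<lambda>e. Poly_Mapping.lookup e x) ` Poly_Mapping.keys q"
    unfolding m_def using assms by (intro Max_in) auto
  then obtain e where e: "e \<in> Poly_Mapping.keys q" "m = Poly_Mapping.lookup e x"
    by auto
  let ?e = "Poly_Mapping.single x 1 + e"
  have nz: "Poly_Mapping.lookup (X y * pscale c q) ?e \<noteq> 0"
    using e(1) unfolding eq[symmetric] by (simp only: in_keys_iff lookup_X_times not_False_eq_True)
  \<comment> \<open>A term of a multiple of \<open>X y\<close> involves \<open>y\<close>. Splitting
    off one factor \<open>y\<close> keeps the exponent of \<open>x\<close>, since
    \<open>x \<noteq> y\<close>.\<close>
  then have "Poly_Mapping.lookup ?e y \<noteq> 0"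
    using lookup_X_times_eq_0[of ?e y "pscale c q"] by argo
  from single_split[OF this] obtain e' where e': "?e = Poly_Mapping.single y 1 + e'" ..
  have "Poly_Mapping.lookup (pscale c q) e' \<noteq> 0"
    using nz unfolding e' lookup_X_times .
  then have "e' \<in> Poly_Mapping.keys q"
    by (auto simp: pscale_def in_keys_iff map.rep_eq when_def)
  then have "Poly_Mapping.lookup e' x \<le> m"
    unfolding m_def by (intro Max_ge) auto
  moreover have "Poly_Mapping.lookup e' x = Suc m"
    using arg_cong[OF e', of "\<lambda>e. Poly_Mapping.lookup e x"] assms(2) e(2)
    by (simp add: lookup_add lookup_single)
  ultimately show False by simp
qed

lemma independent_X_times_pair:
  fixes q :: "'k::field bipoly"
  assumes "q \<noteq> 0" and "x \<noteq> y"
  shows "bipoly.independent {X x * q, X y * q}"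
proof -
  have "X y * q \<noteq> 0"
    using assms X_times_cancel[of y q 0] by auto
  then have "bipoly.independent {X y * q}"
    by simp
  moreover have "X x * q \<notin> bipoly.span {X y * q}"
    using X_times_neq_pscale_X_times[OF assms] by (auto simp: bipoly.span_singleton)
  ultimately show ?thesis
    by (rule bipoly.independent_insertI[rotated])
qed

text \<open>A basis chosen inside the image has \<open>card I\<close> elements, so it is the whole
  image and \<open>p\<close> is injective on \<open>I\<close>.\<close>

lemma independent_family:
  assumes "bipoly.dim (bipoly.span (p ` I)) = card I" and "finite I"
    and "(\<Sum>i\<in>I. pscale (a i) (p i)) = 0" and "i \<in> I"
  shows "a i = 0"
proof -
  obtain B where B: "B \<subseteq> p ` I" "bipoly.independent B" "p ` I \<subseteq> bipoly.span B"
    using bipoly.maximal_independent_subset by blast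
  then have "card B = card I"
    using bipoly.basis_card_eq_dim assms(1) by (metis bipoly.dim_span)
  moreover have "card (p ` I) \<le> card I"
    using assms(2) by (rule card_image_le)
  ultimately have "B = p ` I" "card (p ` I) = card I"
    using B(1) assms(2) by (metis card_mono card_seteq finite_imageI le_antisym)+
  then have ind: "bipoly.independent (p ` I)" and inj: "inj_on p I"
    using B(2) assms(2) by (auto intro: eq_card_imp_inj_on)
  \<comment> \<open>Independence concerns sets of vectors, so the coefficients are moved from
    indices to vectors by inverting \<open>p\<close>.\<close>
  have "(\<Sum>v\<in>p ` I. pscale (a (inv_into I p v)) v) = 0"
    using inj assms(3) by (simp add: sum.reindex cong: sum.cong)
  then have "a (inv_into I p (p i)) = 0"
    using bipoly.independentD[OF ind _ order_refl, of "\<lambda>v. a (inv_into I p v)" "p i"] assms(2,4) by simp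
  then show ?thesis
    using inj assms(4) by simp
qed

theorem lemma4p1:
  fixes U :: "'k::alg_closed_field bipoly set"
    and p :: "nat \<Rightarrow> 'k bipoly"
  assumes "bipoly.subspace U"
    and "U \<subseteq> bigraded 2 1"
    and "bipoly.dim U = 4"
    and "U = bipoly.span (p ` {..<4})"
    and "\<exists>g. first_syzygy 1 0 p g"
  shows "\<exists>q \<in> bigraded 1 1. \<exists>p2 \<in> bigraded 2 1. \<exists>p3 \<in> bigraded 2 1.
    ideal_gen (p ` {..<4}) = ideal_gen {q * X Var_s, q * X Var_t, p2, p3}"
proof -
  obtain g where g: "\<And>i. i < 4 \<Longrightarrow> g i \<in> bigraded 1 0" "\<exists>i<4. g i \<noteq> 0"
      "(\<Sum>i<4. g i * p i) = 0"
    using assms(5) by (auto simp: first_syzygy_def)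
  have "\<exists>a b. i < 4 \<longrightarrow> g i = pscale a (X Var_s) + pscale b (X Var_t)" for i
    using bigraded_1_0_linear g(1) by blast
  then obtain a b where ab: "\<And>i. i < 4 \<Longrightarrow> g i = pscale (a i) (X Var_s) + pscale (b i) (X Var_t)"
    by metis
  define A where "A = (\<Sum>i<4. pscale (a i) (p i))"
  define B where "B = (\<Sum>i<4. pscale (- b i) (p i))"
  have "(\<Sum>i<4. pscale (c i) (p i)) \<in> U" for c
    unfolding assms(4) by (rule bipoly.span_sum, rule bipoly.span_scale, rule bipoly.span_base) simp
  then have in_U: "A \<in> U" "B \<in> U"
    unfolding A_def B_def by this+
  \<comment> \<open>The sign in \<open>B\<close> turns the syzygy into an equation between two
    multiples of variables.\<close>
  have "X Var_s * A - X Var_t * B = (\<Sum>i<4. g i * p i)"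
    by (simp add: A_def B_def ab pscale_conv_mult sum_distrib_left distrib_left distrib_right sum.distrib
        sum_negf single_uminus ac_simps)
  then have "X Var_s * A = X Var_t * B"
    using g(3) by simp
  then obtain q where q: "A = X Var_t * q" "B = X Var_s * q"
    by (rule X_times_eqE) simp
  have "q \<noteq> 0"
  proof
    assume "q = 0"
    then have "A = 0" "B = 0"
      using q by simp_all
    \<comment> \<open>Four vectors spanning a space of dimension 4 admit no nontrivial relation, so
      every \<open>g i\<close> would vanish.\<close>
    then have "a i = 0" "- b i = 0" if "i < 4" for i
      using independent_family[of p "{..<4}" a i] independent_family[of p "{..<4}" "\<lambda>i. - b i" i]
        assms(3,4) that by (simp_all add: A_def B_def)
    then show False
      using g(2) ab by auto
  qed
  have "q \<in> bigraded 1 1"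
    using in_U(1) assms(2) bigraded_X_t_times_cancel[of q 1 1] q(1) by (auto simp: numeral_2_eq_2)
  let ?S = "{X Var_s * q, X Var_t * q}"
  have "?S \<subseteq> U" "bipoly.independent ?S"
    using in_U q \<open>q \<noteq> 0\<close> independent_X_times_pair by auto
  then obtain C where C: "?S \<subseteq> C" "C \<subseteq> U" "bipoly.independent C" "U \<subseteq> bipoly.span C"
    by (rule bipoly.maximal_independent_subset_extend)
  have "card C = 4"
    using C assms(3) bipoly.basis_card_eq_dim by metis
  \<comment> \<open>Scaling by 1 is the identity, so \<open>c = 1\<close> gives that the two
    products are distinct.\<close>
  moreover have "card ?S = 2"
    using X_times_neq_pscale_X_times[OF \<open>q \<noteq> 0\<close>, of Var_s Var_t 1] by simp
  ultimately have "card (C - ?S) = 2"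
    using C(1) by (simp add: card_Diff_subset)
  \<comment> \<open>The remaining two basis vectors lie in \<open>U\<close>, which gives their
    bidegree.\<close>
  then obtain p2 p3 where "C - ?S = {p2, p3}"
    by (auto simp: card_2_iff)
  then have C_eq: "C = {q * X Var_s, q * X Var_t, p2, p3}"
    using C(1) by (auto simp: mult.commute)
  have "bipoly.span C = U"
    using C assms(1) by (intro bipoly.span_subspace)
  then have "ideal_gen (p ` {..<4}) = ideal_gen C"
    by (metis assms(4) ideal_gen_bipoly_span)
  moreover have "p2 \<in> bigraded 2 1" "p3 \<in> bigraded 2 1"
    using C(2) C_eq assms(2) by auto
  ultimately show ?thesis
    using \<open>q \<in> bigraded 1 1\<close> C_eq by blast
qed

end
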